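(* Let $d\ge 2$, let $M$ be a $K\times d$ matrix with entries in $\{0,1\}$, and let $C=\{x\in\{0,1\}^d : Mx=0\}$ (arithmetic mod 2) be the linear code with check matrix $M$. Let $v\in\{0,1\}^d$. Then $C$ integrates the eigenvector $\phi_v$ of the cube graph $Q_d$ if and only if $v\notin C^\perp$ or $v$ is the zero vector.
   Context: $Q_d$ is the graph with vertex set $\{0,1\}^d$ in which two vertices are adjacent iff they differ in exactly one coordinate. For $v\in\{0,1\}^d$, $\phi_v:\{0,1\}^d\to\mathbb{R}$ is $\phi_v(x)=(-1)^{v^Tx}$; these are the eigenvectors of the graph Laplacian $L=AD^{-1}-I$ of $Q_d$ ($A$ the adjacency matrix, $D$ the diagonal degree matrix). A nonempty subset $W\subset V$ of the vertex set $V$ of a graph integrates a function $\phi:V\to\mathbb{R}$ if $\frac{1}{|W|}\sum_{w\in W}\phi(w)=\frac{1}{|V|}\sum_{v\in V}\phi(v)$. The dual code of $C$ is $C^\perp=\{v\in\{0,1\}^d : v^Tc=0 \text{ (mod 2) for all } c\in C\}$, equivalently the row span of $M$ over the field with two elements. *)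

theory Defs
  imports
    Complex_Main
    "HOL-Library.Z2"
    "Jordan_Normal_Form.Matrix_Kernel"
    "Graph_Theory.Pair_Digraph"
begin

text \<open>
  The set $\{0,1\}^d$ is \<open>carrier_vec d\<close> over the two-element field \<^typ>\<open>bit\<close>.
  Undirected graphs are symmetric digraphs (locale \<^locale>\<open>pair_graph\<close>).
\<close>

definition cube_graph :: "nat \<Rightarrow> bit vec pair_pre_digraph" where
  "cube_graph d = \<lparr>
     pverts = carrier_vec d,
     parcs = {(x, y). x \<in> carrier_vec d \<and> y \<in> carrier_vec d \<and>
                      card {i. i < d \<and> x $ i \<noteq> y $ i} = 1} \<rparr>"

text \<open>
  The matrix $AD^{-1} - I$, acting on functions on the vertex set: its entry at
  $(x, y)$ with $x \neq y$ adjacent is $1 / \deg(y)$.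
\<close>

definition graph_laplacian :: "'a pair_pre_digraph \<Rightarrow> ('a \<Rightarrow> real) \<Rightarrow> 'a \<Rightarrow> real" where
  "graph_laplacian G f x =
     (\<Sum>y \<in> {y. (x, y) \<in> parcs G}. f y / real (out_degree (with_proj G) y)) - f x"

definition integrates :: "'a pair_pre_digraph \<Rightarrow> 'a set \<Rightarrow> ('a \<Rightarrow> real) \<Rightarrow> bool" where
  "integrates G W f \<longleftrightarrow> W \<noteq> {} \<and> W \<subseteq> pverts G \<and>
     (\<Sum>w\<in>W. f w) / real (card W) = (\<Sum>v\<in>pverts G. f v) / real (card (pverts G))"

text \<open>In the exponent, $v^T x$ is the inner product of the 0/1-vectors as natural numbers.\<close>

definition cube_eigenvector :: "bit vec \<Rightarrow> bit vec \<Rightarrow> real" where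
  "cube_eigenvector v x =
     (- 1) ^ (\<Sum>i<dim_vec v. of_bool (v $ i = 1) * of_bool (x $ i = 1))"

definition linear_code :: "bit mat \<Rightarrow> bit vec set" where
  "linear_code M = mat_kernel M"

definition dual_code :: "nat \<Rightarrow> bit vec set \<Rightarrow> bit vec set" where
  "dual_code d C = {v \<in> carrier_vec d. \<forall>c\<in>C. v \<bullet> c = 0}"

lemma finite_carrier_bit_vec: "finite (carrier_vec d :: bit vec set)"
proof -
  have U: "(UNIV :: bit set) = {0, 1}" by auto
  have "carrier_vec d \<subseteq> vec_of_list ` {xs :: bit list. set xs \<subseteq> {0, 1} \<and> length xs = d}"
  proof
    fix x :: "bit vec" assume "x \<in> carrier_vec d"
    then have "x = vec_of_list (list_of_vec x)" "length (list_of_vec x) = d"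
      by (simp_all add: vec_list)
    then show "x \<in> vec_of_list ` {xs. set xs \<subseteq> {0, 1} \<and> length xs = d}"
      using U by (metis (mono_tags, lifting) image_eqI mem_Collect_eq subset_UNIV)
  qed
  then show ?thesis
    by (rule finite_subset) (intro finite_imageI finite_lists_length_eq, simp)
qed

lemma pair_graph_cube_graph: "pair_graph (cube_graph d)"
proof
  have "parcs (cube_graph d) \<subseteq> carrier_vec d \<times> carrier_vec d"
    by (auto simp: cube_graph_def)
  then show "finite (parcs (cube_graph d))"
    using finite_carrier_bit_vec finite_subset by blast
qed (auto simp: cube_graph_def finite_carrier_bit_vec symmetric_def sym_def eq_commute)

lemma cube_neighbours:
  assumes x: "x \<in> carrier_vec d"
  shows "{y. (x, y) \<in> parcs (cube_graph d)} = (\<lambda>i. x + unit_vec d i) ` {..<d}"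
proof (intro equalityI subsetI)
  fix y assume "y \<in> {y. (x, y) \<in> parcs (cube_graph d)}"
  then have y: "y \<in> carrier_vec d" and c: "card {i. i < d \<and> x $ i \<noteq> y $ i} = 1"
    by (auto simp: cube_graph_def)
  from c obtain i where i: "{i. i < d \<and> x $ i \<noteq> y $ i} = {i}"
    by (auto simp: card_1_singleton_iff)
  have iff: "j < d \<and> x $ j \<noteq> y $ j \<longleftrightarrow> j = i" for j
    using i by blast
  then have "i < d" by blast
  have "y = x + unit_vec d i"
  proof
    fix j assume "j < dim_vec (x + unit_vec d i)"
    then have j: "j < d" by simp
    show "y $ j = (x + unit_vec d i) $ j"
      using iff[of j] j x \<open>i < d\<close> by (cases "x $ j"; cases "y $ j"; cases "j = i") simp_all
  qed (use y in simp)
  with \<open>i < d\<close> show "y \<in> (\<lambda>i. x + unit_vec d i) ` {..<d}" by blast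
next
  fix y assume "y \<in> (\<lambda>i. x + unit_vec d i) ` {..<d}"
  then obtain i where i: "i < d" "y = x + unit_vec d i" by auto
  have "x $ j \<noteq> y $ j \<longleftrightarrow> j = i" if "j < d" for j
    using that i x by (cases "x $ j"; cases "j = i") simp_all
  with i have "{j. j < d \<and> x $ j \<noteq> y $ j} = {i}"
    by blast
  then show "y \<in> {y. (x, y) \<in> parcs (cube_graph d)}"
    using x i by (simp add: cube_graph_def)
qed

lemma inj_on_cube_neighbours:
  assumes x: "x \<in> carrier_vec d"
  shows "inj_on (\<lambda>i. x + unit_vec d i :: bit vec) {..<d}"
proof (rule inj_onI)
  fix i j assume ij: "i \<in> {..<d}" "j \<in> {..<d}" "x + unit_vec d i = x + unit_vec d j"
  from ij(3) have "(x + unit_vec d i) $ i = (x + unit_vec d j) $ i" by (rule arg_cong)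
  with ij(1) have "x $ i + unit_vec d i $ i = x $ i + unit_vec d j $ i"
    by (simp only: index_add_vec(1) index_unit_vec(3) lessThan_iff)
  then have "unit_vec d i $ i = (unit_vec d j $ i :: bit)"
    by (rule add_left_imp_eq)
  then show "i = j" using ij(1,2) by (simp split: if_splits)
qed

lemma out_degree_cube_graph:
  assumes x: "x \<in> carrier_vec d"
  shows "out_degree (with_proj (cube_graph d)) x = d"
proof -
  have "out_arcs (with_proj (cube_graph d)) x = Pair x ` {y. (x, y) \<in> parcs (cube_graph d)}"
    by (auto simp: out_arcs_def)
  then have "out_degree (with_proj (cube_graph d)) x = card {y. (x, y) \<in> parcs (cube_graph d)}"
    by (simp add: out_degree_def card_image inj_on_def)
  then show ?thesis
    by (simp add: cube_neighbours[OF x] card_image[OF inj_on_cube_neighbours[OF x]])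
qed

lemma cube_eigenvector_add:
  assumes "v \<in> carrier_vec d" "x \<in> carrier_vec d" "y \<in> carrier_vec d"
  shows "cube_eigenvector v (x + y) = cube_eigenvector v x * cube_eigenvector v y"
proof -
  have "(- 1 :: real) ^ (of_bool (a = 1) * of_bool (b + c = 1))
      = (- 1) ^ (of_bool (a = 1) * of_bool (b = 1)) * (- 1) ^ (of_bool (a = 1) * of_bool (c = 1))"
    for a b c :: bit
    by (cases a; cases b; cases c) auto
  note sign = this
  have "(x + y) $ i = x $ i + y $ i" if "i \<in> {..<dim_vec v}" for i
    using that assms by auto
  then show ?thesis
    unfolding cube_eigenvector_def power_sum prod.distrib[symmetric]
    by (intro prod.cong refl) (simp only: sign)
qed

text \<open>The functions \<^const>\<open>cube_eigenvector\<close> are indeed eigenvectors of the Laplacian.\<close>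

lemma graph_laplacian_cube_eigenvector:
  assumes v: "v \<in> carrier_vec d" and x: "x \<in> carrier_vec d"
  shows "graph_laplacian (cube_graph d) (cube_eigenvector v) x =
    ((\<Sum>i<d. cube_eigenvector v (unit_vec d i)) / real d - 1) * cube_eigenvector v x"
proof -
  have "(\<Sum>y \<in> {y. (x, y) \<in> parcs (cube_graph d)}.
           cube_eigenvector v y / real (out_degree (with_proj (cube_graph d)) y))
      = (\<Sum>i<d. cube_eigenvector v (x + unit_vec d i) / real d)"
    using x by (simp add: cube_neighbours sum.reindex inj_on_cube_neighbours out_degree_cube_graph)
  also have "\<dots> = (\<Sum>i<d. cube_eigenvector v (unit_vec d i)) / real d * cube_eigenvector v x"
    using v x by (simp add: cube_eigenvector_add sum_distrib_left sum_divide_distrib mult.commute)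
  finally show ?thesis
    by (simp add: graph_laplacian_def algebra_simps)
qed

end

theory Submission
  imports Defs
begin

text \<open>
  The function \<^term>\<open>cube_eigenvector v\<close> is the sign character \<open>x \<mapsto> (- 1)\<^bsup>v \<bullet> x\<^esup>\<close> of the
  additive group \<open>{0,1}\<^sup>d\<close>, and both the code and the whole cube are subgroups. The sum of a
  character over a finite subgroup \<open>H\<close> is \<open>|H|\<close> if the character is trivial on \<open>H\<close>, that is,
  if \<open>v\<close> lies in the dual code of \<open>H\<close>, and is zero otherwise (\<open>average_cube_eigenvector\<close>).
  So the average over the code is 1 or 0 according to whether \<open>v\<close> lies in the dual code.
  The dual of the whole cube is trivial (\<open>dual_code_carrier_vec\<close>), so the average over the cube
  is 1 if \<open>v\<close> is zero and 0 otherwise. The two averages differ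
  precisely when \<open>v\<close> is a nonzero element of the dual code.
\<close>

text \<open>
  The exponent that defines the eigenvector is the inner product over the natural numbers, and
  only its parity matters for the sign.
\<close>
lemma cube_eigenvector_eq:
  assumes "v \<in> carrier_vec d" "x \<in> carrier_vec d"
  shows "cube_eigenvector v x = (if v \<bullet> x = 0 then 1 else - 1)"
proof -
  let ?n = "\<Sum>i<dim_vec v. of_bool (v $ i = 1) * of_bool (x $ i = 1) :: nat"
  have bits: "a * b = (of_nat (of_bool (a = 1) * of_bool (b = 1)) :: bit)" for a b :: bit
    by (cases a; cases b) auto
  have "v \<bullet> x = (\<Sum>i<dim_vec v. v $ i * x $ i)"
    using assms by (simp add: scalar_prod_def lessThan_atLeast0)
  also have "\<dots> = of_nat ?n"
    by (simp only: bits of_nat_sum)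
  finally have "v \<bullet> x = 0 \<longleftrightarrow> even ?n"
    by (cases "even ?n") (auto elim!: evenE oddE)
  then show ?thesis
    by (simp add: cube_eigenvector_def)
qed

text \<open>
  If the character takes the value \<open>- 1\<close> at some \<open>c\<close> in \<open>H\<close>, then translation by \<open>c\<close> permutes \<open>H\<close>
  and negates the sum, which is therefore zero. Over the two-element field, closure under addition
  is all that makes a nonempty set a subgroup, since every element is its own negative.
\<close>
lemma average_cube_eigenvector:
  assumes v: "v \<in> carrier_vec d" and H: "H \<subseteq> carrier_vec d" "H \<noteq> {}"
    and add: "\<And>x y. x \<in> H \<Longrightarrow> y \<in> H \<Longrightarrow> x + y \<in> H"
  shows "(\<Sum>x\<in>H. cube_eigenvector v x) / real (card H) = of_bool (v \<in> dual_code d H)"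
proof (cases "v \<in> dual_code d H")
  case True
  then have "cube_eigenvector v x = 1" if "x \<in> H" for x
    using that v H(1) by (auto simp: dual_code_def cube_eigenvector_eq)
  moreover have "card H > 0"
    using H finite_subset[OF H(1) finite_carrier_bit_vec] by (simp add: card_gt_0_iff)
  ultimately show ?thesis
    using True by simp
next
  case False
  then obtain c where c: "c \<in> H" "v \<bullet> c \<noteq> 0"
    using v by (auto simp: dual_code_def)
  have involution: "x + c + c = x" if "x \<in> H" for x
  proof -
    have "x \<in> carrier_vec d" "c \<in> carrier_vec d"
      using that c(1) H(1) by auto
    moreover have "a + b + b = a" for a b :: bit
      by (cases a; cases b) auto
    ultimately show ?thesis
      by (intro eq_vecI) simp_all
  qed
  have sign: "cube_eigenvector v (x + c) = - cube_eigenvector v x" if "x \<in> H" for x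
  proof -
    have "x \<in> carrier_vec d" "c \<in> carrier_vec d"
      using that c(1) H(1) by auto
    then show ?thesis
      using v c(2) by (simp add: cube_eigenvector_add cube_eigenvector_eq[of v d c])
  qed
  have "(\<Sum>x\<in>H. cube_eigenvector v x) = (\<Sum>x\<in>H. cube_eigenvector v (x + c))"
    by (rule sum.reindex_bij_witness[where i = "\<lambda>x. x + c" and j = "\<lambda>x. x + c"])
      (simp_all add: involution add c(1))
  also have "\<dots> = - (\<Sum>x\<in>H. cube_eigenvector v x)"
    by (simp add: sign sum_negf)
  finally show ?thesis
    using False by simp
qed

lemma dual_code_carrier_vec: "dual_code d (carrier_vec d) = {0\<^sub>v d}"
proof (intro equalityI subsetI)
  fix v :: "bit vec" assume v: "v \<in> dual_code d (carrier_vec d)"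
  have "v $ i = 0" if "i < d" for i
  proof -
    have "v \<bullet> unit_vec d i = 0"
      using v by (simp add: dual_code_def)
    then show ?thesis
      using that by simp
  qed
  with v show "v \<in> {0\<^sub>v d}"
    by (auto simp: dual_code_def intro!: eq_vecI)
qed (auto simp: dual_code_def)

theorem theorem4p8:
  fixes d K :: nat and M :: "bit mat" and v :: "bit vec"
  assumes "d \<ge> 2"
    and "M \<in> carrier_mat K d"
    and "v \<in> carrier_vec d"
  shows "integrates (cube_graph d) (linear_code M) (cube_eigenvector v) \<longleftrightarrow>
    v \<notin> dual_code d (linear_code M) \<or> v = 0\<^sub>v d"
proof -
  let ?C = "linear_code M"
  have C: "?C = {x \<in> carrier_vec d. M *\<^sub>v x = 0\<^sub>v K}"
    using assms(2) by (auto simp: linear_code_def mat_kernel_def)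
  have sub: "?C \<subseteq> carrier_vec d"
    by (auto simp: C)
  have "0\<^sub>v d \<in> ?C"
    using assms(2) by (auto simp: C)
  then have ne: "?C \<noteq> {}"
    by blast
  have add: "x + y \<in> ?C" if "x \<in> ?C" "y \<in> ?C" for x y
    using that assms(2) by (auto simp: C mult_add_distrib_mat_vec)
  have code: "(\<Sum>x\<in>?C. cube_eigenvector v x) / real (card ?C) = of_bool (v \<in> dual_code d ?C)"
    by (rule average_cube_eigenvector[OF assms(3) sub ne add])
  have nonempty: "(carrier_vec d :: bit vec set) \<noteq> {}"
    using sub ne by blast
  have cube: "(\<Sum>x\<in>carrier_vec d. cube_eigenvector v x) / real (card (carrier_vec d :: bit vec set))
      = of_bool (v = 0\<^sub>v d)"
    using average_cube_eigenvector[OF assms(3), of "carrier_vec d"] nonempty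
    unfolding dual_code_carrier_vec by (simp only: singleton_iff add_carrier_vec subset_refl simp_thms)
  have "0\<^sub>v d \<in> dual_code d ?C"
    using sub by (auto simp: dual_code_def)
  then show ?thesis
    using sub ne by (auto simp: integrates_def cube_graph_def code cube)
qed

end
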